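(* Let $\mathbf{k}$ be a commutative ring with unit. For every planar binary tree $T\in\mathcal{Y}$, one has $$\Delta_{\rm LR}^{\epsilon}(T)=\sum_{e\in\mathrm{Int}(T)}P^e(T)\otimes R^e(T),$$ where $\mathrm{Int}(T)$ is the set of internal vertices of $T$ and $(P^e(T),R^e(T))$ is the elementary cut of $T$ at $e$.
   Context: All modules, tensor products and linear maps are over $\mathbf{k}$. Planar binary trees: a planar binary tree is a finite rooted planar tree in which every internal vertex has exactly two ordered incoming branches (left and right). The trivial tree, with no internal vertices, is denoted $|$. Let $\mathcal{Y}$ be the set of planar binary trees and $H_{\rm LR}^{\epsilon}:=\mathbf{k}\mathcal{Y}$ the free $\mathbf{k}$-module on it. For $T\in\mathcal Y$, $\mathrm{Int}(T)$ is the set of internal vertices of $T$; $\mathrm{Int}(|)=\emptyset$. Grafting: for $T_l,T_r\in\mathcal{Y}$, $T_l\vee T_r$ is the tree obtained by creating a new root with left branch $T_l$ and right branch $T_r$; $\vee$ is extended bilinearly. Every $T\in\mathcal{Y}$ with $T\neq |$ is uniquely of the form $T=T_l\vee T_r$. Infinitesimal coproduct: the linear map $\Delta_{\rm LR}^{\epsilon}:H_{\rm LR}^{\epsilon}\to H_{\rm LR}^{\epsilon}\otimes H_{\rm LR}^{\epsilon}$ defined on trees recursively by $\Delta_{\rm LR}^{\epsilon}(|)=0$ and $$\Delta_{\rm LR}^{\epsilon}(T_l\vee T_r)=T_l\otimes T_r+(\mathrm{id}\otimes\vee)(\Delta_{\rm LR}^{\epsilon}(T_l)\otimes T_r)+(\vee\otimes\mathrm{id})(T_l\otimes\Delta_{\rm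 LR}^{\epsilon}(T_r)).$$ Elementary cut: for $T\in\mathcal{Y}$ and $e\in\mathrm{Int}(T)$, the elementary cut of $T$ at $e$ is the pair $(P^e(T),R^e(T))\in\mathcal{Y}\times\mathcal{Y}$ defined recursively as follows. Write $T=T_l\vee T_r$ with root vertex $\rho_T$, so $\mathrm{Int}(T)=\{\rho_T\}\sqcup\mathrm{Int}(T_l)\sqcup\mathrm{Int}(T_r)$. Then $$(P^e(T),R^e(T)):=\begin{cases}(T_l,T_r), & e=\rho_T,\\ (P^e(T_l),\,R^e(T_l)\vee T_r), & e\in\mathrm{Int}(T_l),\\ (T_l\vee P^e(T_r),\,R^e(T_r)), & e\in\mathrm{Int}(T_r).\end{cases}$$ (In particular, for $T=|\vee|$ the only cut is $(|,|)$; the trivial tree has no elementary cut.) *)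

theory Defs
  imports "HOL-Library.Poly_Mapping"
begin

(* The scalars range over the sort {comm_ring, comm_monoid_mult} rather than comm_ring_1:
   the latter contains the axiom 0 \<noteq> 1 and hence excludes the zero ring. *)

section \<open>Free modules and their tensor products\<close>

text \<open>The free module on a set of generators \<open>'a\<close> is \<open>'a \<Rightarrow>\<^sub>0 'k\<close>.\<close>

definition smult :: "'k::{comm_ring,comm_monoid_mult} \<Rightarrow> ('a \<Rightarrow>\<^sub>0 'k) \<Rightarrow> ('a \<Rightarrow>\<^sub>0 'k)" where
  "smult c x = Poly_Mapping.map ((*) c) x"

definition basis :: "'a \<Rightarrow> ('a \<Rightarrow>\<^sub>0 'k::{comm_ring,comm_monoid_mult})" where
  "basis a = Poly_Mapping.single a 1"

text \<open>The linear extension of a map defined on the generators.\<close>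

definition lin_ext ::
    "('a \<Rightarrow> ('b \<Rightarrow>\<^sub>0 'k)) \<Rightarrow> ('a \<Rightarrow>\<^sub>0 'k::{comm_ring,comm_monoid_mult}) \<Rightarrow> ('b \<Rightarrow>\<^sub>0 'k)" where
  "lin_ext f x = (\<Sum>a\<in>Poly_Mapping.keys x. smult (Poly_Mapping.lookup x a) (f a))"

text \<open>
  The tensor product of the free modules on \<open>'a\<close> and on \<open>'b\<close> is realised as the free module on
  \<open>'a \<times> 'b\<close>, together with the bilinear map below; \<open>tensor_universal\<close> is its universal property.
\<close>

definition tensor ::
    "('a \<Rightarrow>\<^sub>0 'k::{comm_ring,comm_monoid_mult}) \<Rightarrow> ('b \<Rightarrow>\<^sub>0 'k) \<Rightarrow> ('a \<times> 'b \<Rightarrow>\<^sub>0 'k)"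
    (infixl "\<otimes>" 70) where
  "x \<otimes> y = (\<Sum>a\<in>Poly_Mapping.keys x. \<Sum>b\<in>Poly_Mapping.keys y.
      Poly_Mapping.single (a, b) (Poly_Mapping.lookup x a * Poly_Mapping.lookup y b))"

text \<open>The tensor product of two linear maps.\<close>

definition tensor_map ::
    "(('a \<Rightarrow>\<^sub>0 'k) \<Rightarrow> ('c \<Rightarrow>\<^sub>0 'k)) \<Rightarrow> (('b \<Rightarrow>\<^sub>0 'k) \<Rightarrow> ('d \<Rightarrow>\<^sub>0 'k)) \<Rightarrow>
     ('a \<times> 'b \<Rightarrow>\<^sub>0 'k::{comm_ring,comm_monoid_mult}) \<Rightarrow> ('c \<times> 'd \<Rightarrow>\<^sub>0 'k)" where
  "tensor_map f g = lin_ext (\<lambda>(a, b). f (basis a) \<otimes> g (basis b))"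

text \<open>The identification of \<open>(A \<otimes> B) \<otimes> C\<close> with \<open>A \<otimes> (B \<otimes> C)\<close>, in both directions.\<close>

definition tensor_assoc ::
    "(('a \<times> 'b) \<times> 'c \<Rightarrow>\<^sub>0 'k::{comm_ring,comm_monoid_mult}) \<Rightarrow> ('a \<times> ('b \<times> 'c) \<Rightarrow>\<^sub>0 'k)" where
  "tensor_assoc = lin_ext (\<lambda>((a, b), c). basis (a, (b, c)))"

definition tensor_assoc' ::
    "('a \<times> ('b \<times> 'c) \<Rightarrow>\<^sub>0 'k::{comm_ring,comm_monoid_mult}) \<Rightarrow> (('a \<times> 'b) \<times> 'c \<Rightarrow>\<^sub>0 'k)" where
  "tensor_assoc' = lin_ext (\<lambda>(a, (b, c)). basis ((a, b), c))"


subsection \<open>Basic facts\<close>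

lemma lookup_smult [simp]:
  "Poly_Mapping.lookup (smult c x) a = c * Poly_Mapping.lookup x a"
  by (simp add: smult_def Poly_Mapping.map.rep_eq when_def)

lemma smult_add_right: "smult c (x + y) = smult c x + smult c y"
  by (rule poly_mapping_eqI) (simp add: lookup_add distrib_left)

lemma smult_add_left: "smult (c + d) x = smult c x + smult d x"
  by (rule poly_mapping_eqI) (simp add: lookup_add distrib_right)

lemma smult_smult: "smult c (smult d x) = smult (c * d) x"
  by (rule poly_mapping_eqI) (simp add: mult.assoc)

lemma smult_1 [simp]: "smult 1 x = x"
  by (rule poly_mapping_eqI) simp

lemma smult_0_left [simp]: "smult 0 x = 0"
  by (rule poly_mapping_eqI) simp

lemma smult_0_right [simp]: "smult c 0 = 0"
  by (rule poly_mapping_eqI) simp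

lemma smult_sum: "smult c (sum f A) = (\<Sum>i\<in>A. smult c (f i))"
  by (rule poly_mapping_eqI) (simp add: lookup_sum sum_distrib_left)

lemma lin_ext_superset:
  assumes "finite A" "Poly_Mapping.keys x \<subseteq> A"
  shows "lin_ext f x = (\<Sum>a\<in>A. smult (Poly_Mapping.lookup x a) (f a))"
  unfolding lin_ext_def using assms
  by (intro sum.mono_neutral_left) (auto simp: in_keys_iff)

lemma lin_ext_add: "lin_ext f (x + y) = lin_ext f x + lin_ext f y"
proof -
  let ?A = "Poly_Mapping.keys x \<union> Poly_Mapping.keys y"
  have "lin_ext f z = (\<Sum>a\<in>?A. smult (Poly_Mapping.lookup z a) (f a))"
    if "z \<in> {x, y, x + y}" for z
    using that Poly_Mapping.keys_add[of x y] by (intro lin_ext_superset) auto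
  then show ?thesis
    by (simp add: lookup_add smult_add_left sum.distrib)
qed

lemma lin_ext_smult: "lin_ext f (smult c x) = smult c (lin_ext f x)"
proof -
  have "Poly_Mapping.keys (smult c x) \<subseteq> Poly_Mapping.keys x"
    by (auto simp: in_keys_iff)
  then have "lin_ext f (smult c x) =
      (\<Sum>a\<in>Poly_Mapping.keys x. smult (Poly_Mapping.lookup (smult c x) a) (f a))"
    by (intro lin_ext_superset) auto
  then show ?thesis
    by (simp add: lin_ext_def smult_sum smult_smult)
qed

lemma lin_ext_basis [simp]: "lin_ext f (basis a) = f a"
proof -
  have "lin_ext f (basis a) = (\<Sum>b\<in>{a}. smult (Poly_Mapping.lookup (basis a) b) (f b))"
    by (intro lin_ext_superset) (auto simp: basis_def in_keys_iff lookup_single when_def)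
  then show ?thesis
    by (simp add: basis_def)
qed

lemma lookup_tensor [simp]:
  "Poly_Mapping.lookup (x \<otimes> y) (a, b) = Poly_Mapping.lookup x a * Poly_Mapping.lookup y b"
proof -
  have "Poly_Mapping.lookup (x \<otimes> y) (a, b) =
      (\<Sum>a'\<in>Poly_Mapping.keys x. \<Sum>b'\<in>Poly_Mapping.keys y. if a' = a then
         (if b' = b then Poly_Mapping.lookup x a' * Poly_Mapping.lookup y b' else 0) else 0)"
    by (auto simp: tensor_def lookup_sum lookup_single when_def intro!: sum.cong)
  also have "\<dots> = (\<Sum>a'\<in>Poly_Mapping.keys x. if a' = a then (\<Sum>b'\<in>Poly_Mapping.keys y. 
         (if b' = b then Poly_Mapping.lookup x a' * Poly_Mapping.lookup y b' else 0)) else 0)"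
    by (intro sum.cong) auto
  also have "\<dots> = Poly_Mapping.lookup x a * Poly_Mapping.lookup y b"
    by (simp add: sum.delta in_keys_iff)
  finally show ?thesis .
qed

lemma tensor_add_left: "(x + x') \<otimes> y = x \<otimes> y + x' \<otimes> y"
  by (rule poly_mapping_eqI) (auto simp: lookup_add distrib_right)

lemma tensor_add_right: "x \<otimes> (y + y') = x \<otimes> y + x \<otimes> y'"
  by (rule poly_mapping_eqI) (auto simp: lookup_add distrib_left)

lemma tensor_smult_left: "smult c x \<otimes> y = smult c (x \<otimes> y)"
  by (rule poly_mapping_eqI) (auto simp: mult.assoc)

lemma tensor_smult_right: "x \<otimes> smult c y = smult c (x \<otimes> y)"
  by (rule poly_mapping_eqI) (auto simp: mult.left_commute)

lemma basis_tensor_basis [simp]: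
  fixes a :: 'a and b :: 'c
  shows "basis a \<otimes> basis b = basis (a, b)"
proof (rule poly_mapping_eqI)
  fix p :: "'a \<times> 'c"
  show "Poly_Mapping.lookup (basis a \<otimes> basis b) p = Poly_Mapping.lookup (basis (a, b)) p"
    by (cases p, cases "fst p = a"; cases "snd p = b") (simp_all add: basis_def lookup_single)
qed

lemma expand_basis:
  "x = (\<Sum>a\<in>Poly_Mapping.keys x. smult (Poly_Mapping.lookup x a) (basis a))"
proof (rule poly_mapping_eqI)
  fix b
  have "Poly_Mapping.lookup (\<Sum>a\<in>Poly_Mapping.keys x. smult (Poly_Mapping.lookup x a) (basis a)) b
      = (\<Sum>a\<in>Poly_Mapping.keys x. if a = b then Poly_Mapping.lookup x a else 0)"
    unfolding lookup_sum
    by (intro sum.cong) (auto simp: basis_def lookup_single when_def)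
  then show "Poly_Mapping.lookup x b = Poly_Mapping.lookup
      (\<Sum>a\<in>Poly_Mapping.keys x. smult (Poly_Mapping.lookup x a) (basis a)) b"
    by (simp add: in_keys_iff)
qed

lemma additive_sum:
  fixes h :: "'m::ab_group_add \<Rightarrow> 'n::ab_group_add"
  assumes "\<And>u v. h (u + v) = h u + h v"
  shows "h (sum f A) = (\<Sum>i\<in>A. h (f i))"
proof -
  have "h 0 = 0" using assms[of 0 0] by simp
  then show ?thesis using assms by (induction A rule: infinite_finite_induct) auto
qed

theorem tensor_universal:
  fixes sc :: "'k::{comm_ring,comm_monoid_mult} \<Rightarrow> 'm::ab_group_add \<Rightarrow> 'm"
    and B :: "('a \<Rightarrow>\<^sub>0 'k) \<Rightarrow> ('b \<Rightarrow>\<^sub>0 'k) \<Rightarrow> 'm"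
  assumes sc: "\<And>c u v. sc c (u + v) = sc c u + sc c v"
      "\<And>c d u. sc (c + d) u = sc c u + sc d u"
      "\<And>c d u. sc c (sc d u) = sc (c * d) u"
      "\<And>u. sc 1 u = u"
    and B: "\<And>x x' y. B (x + x') y = B x y + B x' y"
      "\<And>x y y'. B x (y + y') = B x y + B x y'"
      "\<And>c x y. B (smult c x) y = sc c (B x y)"
      "\<And>c x y. B x (smult c y) = sc c (B x y)"
  shows "\<exists>!h :: ('a \<times> 'b \<Rightarrow>\<^sub>0 'k) \<Rightarrow> 'm.
    (\<forall>z z'. h (z + z') = h z + h z') \<and> (\<forall>c z. h (smult c z) = sc c (h z)) \<and>
    (\<forall>x y. h (x \<otimes> y) = B x y)"
proof -
  have sc0: "sc 0 u = 0" for u using sc(2)[of 0 0 u] by simp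
  have uniq: "h z = h' z"
    if h: "\<And>z z'. h (z + z') = h z + h z'" "\<And>c z. h (smult c z) = sc c (h z)"
      and h': "\<And>z z'. h' (z + z') = h' z + h' z'" "\<And>c z. h' (smult c z) = sc c (h' z)"
      and eq: "\<And>a. h (basis a) = h' (basis a)"
    for h h' :: "('e \<Rightarrow>\<^sub>0 'k) \<Rightarrow> 'm" and z
    by (subst (1 2) expand_basis[of z], subst additive_sum[of h, OF h(1)],
        subst additive_sum[of h', OF h'(1)]) (simp add: h(2) h'(2) eq)
  define H where "H = (\<lambda>z :: 'a \<times> 'b \<Rightarrow>\<^sub>0 'k. \<Sum>p\<in>Poly_Mapping.keys z.
      sc (Poly_Mapping.lookup z p) (B (basis (fst p)) (basis (snd p))))"
  have H_sup: "H z = (\<Sum>p\<in>A. sc (Poly_Mapping.lookup z p) (B (basis (fst p)) (basis (snd p))))"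
    if "finite A" "Poly_Mapping.keys z \<subseteq> A" for z A
    unfolding H_def using that by (intro sum.mono_neutral_left) (auto simp: in_keys_iff sc0)
  have H_add: "H (z + z') = H z + H z'" for z z'
  proof -
    let ?A = "Poly_Mapping.keys z \<union> Poly_Mapping.keys z'"
    have "H u = (\<Sum>p\<in>?A. sc (Poly_Mapping.lookup u p) (B (basis (fst p)) (basis (snd p))))"
      if "u \<in> {z, z', z + z'}" for u
      using that Poly_Mapping.keys_add[of z z'] by (intro H_sup) auto
    then show ?thesis by (simp add: lookup_add sc(2) sum.distrib)
  qed
  have H_sc: "H (smult c z) = sc c (H z)" for c z
  proof -
    have "Poly_Mapping.keys (smult c z) \<subseteq> Poly_Mapping.keys z"
      by (auto simp: in_keys_iff)
    then have "H (smult c z) = (\<Sum>p\<in>Poly_Mapping.keys z.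
        sc (Poly_Mapping.lookup (smult c z) p) (B (basis (fst p)) (basis (snd p))))"
      by (intro H_sup) auto
    then show ?thesis
      by (simp add: H_def additive_sum[of "sc c", OF sc(1)] sc(3))
  qed
  have H_basis: "H (basis (a, b)) = B (basis a) (basis b)" for a b
  proof -
    have "H (basis (a, b)) = (\<Sum>p\<in>{(a, b)}.
        sc (Poly_Mapping.lookup (basis (a, b)) p) (B (basis (fst p)) (basis (snd p))))"
      by (intro H_sup) (auto simp: basis_def in_keys_iff lookup_single when_def)
    then show ?thesis by (simp add: basis_def sc(4))
  qed
  have H_tensor: "H (x \<otimes> y) = B x y" for x y
  proof -
    have *: "H (basis a \<otimes> y) = B (basis a) y" for a
      by (rule uniq[of "\<lambda>y. H (basis a \<otimes> y)" "B (basis a)"])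
        (simp_all add: tensor_add_right tensor_smult_right H_add H_sc B H_basis)
    show ?thesis
      by (rule uniq[of "\<lambda>x. H (x \<otimes> y)" "\<lambda>x. B x y"])
        (simp_all add: tensor_add_left tensor_smult_left H_add H_sc B *)
  qed
  show ?thesis
  proof (rule ex1I[of _ H])
    show "(\<forall>z z'. H (z + z') = H z + H z') \<and> (\<forall>c z. H (smult c z) = sc c (H z)) \<and>
        (\<forall>x y. H (x \<otimes> y) = B x y)"
      by (simp add: H_add H_sc H_tensor)
  next
    fix h :: "('a \<times> 'b \<Rightarrow>\<^sub>0 'k) \<Rightarrow> 'm"
    assume h: "(\<forall>z z'. h (z + z') = h z + h z') \<and> (\<forall>c z. h (smult c z) = sc c (h z)) \<and>
        (\<forall>x y. h (x \<otimes> y) = B x y)"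
    have h_basis: "h (basis p) = H (basis p)" for p
    proof (cases p)
      case (Pair a b)
      have "h (basis a \<otimes> basis b) = B (basis a) (basis b)" using h by blast
      then show ?thesis by (simp add: Pair H_basis)
    qed
    have h_lin: "h (z + z') = h z + h z'" "h (smult c z) = sc c (h z)" for z z' c
      using h by blast+
    have "h z = H z" for z
      by (rule uniq[of h H, OF h_lin H_add H_sc h_basis])
    then show "h = H" by blast
  qed
qed


section \<open>Planar binary trees\<close>

datatype pbt = Triv | Graft pbt pbt

text \<open>
  Internal vertices are encoded by their addresses: the sequence of branches followed from the root.
\<close>

datatype branch = Lft | Rgt

fun Int_vertices :: "pbt \<Rightarrow> branch list set" where
  "Int_vertices Triv = {}"
| "Int_vertices (Graft l r) = {[]} \<union> Cons Lft ` Int_vertices l \<union> Cons Rgt ` Int_vertices r"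

text \<open>The elementary cut; it is unspecified when the address is not an internal vertex.\<close>

fun cut :: "pbt \<Rightarrow> branch list \<Rightarrow> pbt \<times> pbt" where
  "cut (Graft l r) [] = (l, r)"
| "cut (Graft l r) (Lft # e) = (fst (cut l e), Graft (snd (cut l e)) r)"
| "cut (Graft l r) (Rgt # e) = (Graft l (fst (cut r e)), snd (cut r e))"

definition P_cut :: "branch list \<Rightarrow> pbt \<Rightarrow> pbt" where
  "P_cut e T = fst (cut T e)"

definition R_cut :: "branch list \<Rightarrow> pbt \<Rightarrow> pbt" where
  "R_cut e T = snd (cut T e)"

lemma finite_Int_vertices [simp]: "finite (Int_vertices T)"
  by (induction T) auto


section \<open>The infinitesimal coproduct\<close>

type_synonym 'k H_LR = "pbt \<Rightarrow>\<^sub>0 'k"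

text \<open>The grafting product as a linear map \<open>H \<otimes> H \<rightarrow> H\<close>.\<close>

definition vee :: "(pbt \<times> pbt \<Rightarrow>\<^sub>0 'k) \<Rightarrow> 'k::{comm_ring,comm_monoid_mult} H_LR" where
  "vee = lin_ext (\<lambda>(S, T). basis (Graft S T))"

primrec coprod_tree :: "pbt \<Rightarrow> (pbt \<times> pbt \<Rightarrow>\<^sub>0 'k::{comm_ring,comm_monoid_mult})" where
  "coprod_tree Triv = 0"
| "coprod_tree (Graft l r) =
     basis l \<otimes> basis r
     + tensor_map id vee (tensor_assoc (coprod_tree l \<otimes> basis r))
     + tensor_map vee id (tensor_assoc' (basis l \<otimes> coprod_tree r))"

definition \<Delta>_LR :: "'k::{comm_ring,comm_monoid_mult} H_LR \<Rightarrow> (pbt \<times> pbt \<Rightarrow>\<^sub>0 'k)" where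
  "\<Delta>_LR = lin_ext coprod_tree"

lemma \<Delta>_LR_linear:
  "\<Delta>_LR (x + y) = \<Delta>_LR x + \<Delta>_LR y"
  "\<Delta>_LR (smult c x) = smult c (\<Delta>_LR x)"
  by (simp_all add: \<Delta>_LR_def lin_ext_add lin_ext_smult)

lemma \<Delta>_LR_rec:
  "\<Delta>_LR (basis Triv) = 0"
  "\<Delta>_LR (vee (basis l \<otimes> basis r)) =
     basis l \<otimes> basis r
     + tensor_map id vee (tensor_assoc (\<Delta>_LR (basis l) \<otimes> basis r))
     + tensor_map vee id (tensor_assoc' (basis l \<otimes> \<Delta>_LR (basis r)))"
  by (simp_all add: \<Delta>_LR_def vee_def)

end

theory Submission
  imports Defs
begin

text \<open>
  The three summands in the recursion for the coproduct of \<open>l \<or> r\<close> match the three kinds of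
  internal vertex of \<open>l \<or> r\<close>. The root contributes \<open>l \<otimes> r\<close>. By induction, \<open>\<Delta>(l)\<close> is the sum of
  its cuts \<open>P \<otimes> R\<close>, and the second summand of the recursion turns each of them into
  \<open>P \<otimes> (R \<or> r)\<close>, which is what the recursion for elementary cuts does at a vertex of \<open>l\<close>; the
  third summand does the same for the vertices of \<open>r\<close>. As the operators in the second and third
  summands are linear, they may be evaluated cut by cut, so it is enough to know them on basis
  elements (\<open>graft_right_basis\<close> and \<open>graft_left_basis\<close>).
\<close>

lemma lin_ext_sum: "lin_ext f (sum g A) = (\<Sum>i\<in>A. lin_ext f (g i))"
  by (rule additive_sum) (rule lin_ext_add)

lemma tensor_sum_left: "sum g A \<otimes> y = (\<Sum>i\<in>A. g i \<otimes> y)"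
  by (rule additive_sum[of "\<lambda>x. x \<otimes> y"]) (rule tensor_add_left)

lemma tensor_sum_right: "x \<otimes> sum g A = (\<Sum>i\<in>A. x \<otimes> g i)"
  by (rule additive_sum) (rule tensor_add_right)

lemma graft_right_basis:
  "tensor_map id vee (tensor_assoc (basis (P, R) \<otimes> basis r)) = basis (P, Graft R r)"
  by (simp add: tensor_map_def tensor_assoc_def vee_def)

lemma graft_left_basis:
  "tensor_map vee id (tensor_assoc' (basis l \<otimes> basis (P, R))) = basis (Graft l P, R)"
  by (simp add: tensor_map_def tensor_assoc'_def vee_def)

lemma graft_right_sum:
  "tensor_map id vee (tensor_assoc (sum g A \<otimes> y)) =
    (\<Sum>i\<in>A. tensor_map id vee (tensor_assoc (g i \<otimes> y)))"
  by (simp add: tensor_map_def tensor_assoc_def tensor_sum_left lin_ext_sum)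

lemma graft_left_sum:
  "tensor_map vee id (tensor_assoc' (x \<otimes> sum g A)) =
    (\<Sum>i\<in>A. tensor_map vee id (tensor_assoc' (x \<otimes> g i)))"
  by (simp add: tensor_map_def tensor_assoc'_def tensor_sum_right lin_ext_sum)

lemma sum_Int_vertices_Graft:
  fixes f :: "branch list \<Rightarrow> 'm::comm_monoid_add"
  shows "(\<Sum>e\<in>Int_vertices (Graft l r). f e) =
    f [] + (\<Sum>e\<in>Int_vertices l. f (Lft # e)) + (\<Sum>e\<in>Int_vertices r. f (Rgt # e))"
proof -
  let ?L = "Cons Lft ` Int_vertices l" and ?R = "Cons Rgt ` Int_vertices r"
  have "sum f (Int_vertices (Graft l r)) = f [] + sum f (?L \<union> ?R)"
    by (simp add: Un_assoc image_iff)
  also have "sum f (?L \<union> ?R) = sum f ?L + sum f ?R"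
    by (rule sum.union_disjoint) auto
  finally show ?thesis
    by (simp add: sum.reindex add.assoc)
qed

lemma coprod_tree_eq_sum_cuts:
  "(coprod_tree T :: pbt \<times> pbt \<Rightarrow>\<^sub>0 'k::{comm_ring,comm_monoid_mult})
    = (\<Sum>e\<in>Int_vertices T. basis (cut T e))"
proof (induction T)
  case Triv
  show ?case by simp
next
  case (Graft l r)
  have "tensor_map id vee (tensor_assoc (basis (cut l e) \<otimes> basis r)) =
      (basis (cut (Graft l r) (Lft # e)) :: _ \<Rightarrow>\<^sub>0 'k)" for e
    by (cases "cut l e") (simp add: graft_right_basis del: basis_tensor_basis)
  moreover have "tensor_map vee id (tensor_assoc' (basis l \<otimes> basis (cut r e))) =
      (basis (cut (Graft l r) (Rgt # e)) :: _ \<Rightarrow>\<^sub>0 'k)" for e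
    by (cases "cut r e") (simp add: graft_left_basis del: basis_tensor_basis)
  ultimately show ?case
    by (simp only: coprod_tree.simps Graft.IH graft_right_sum graft_left_sum
        sum_Int_vertices_Graft cut.simps(1) basis_tensor_basis[of l r])
qed

theorem theorem2p10:
  fixes T :: pbt
  shows "(\<Delta>_LR (basis T) :: pbt \<times> pbt \<Rightarrow>\<^sub>0 'k::{comm_ring,comm_monoid_mult})
    = (\<Sum>e\<in>Int_vertices T. basis (P_cut e T) \<otimes> basis (R_cut e T))"
  by (simp add: \<Delta>_LR_def coprod_tree_eq_sum_cuts P_cut_def R_cut_def)

end
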